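(* Let $n\ge 1$ and let $B$ be a commutative group. The functions $f\colon\mathbb{Z}^n\to B$ with $\mathrm{Fdeg}(f)<\infty$ are exactly the functions that are given by $B$-polyfracts in $n$ variables. Moreover, if such an $f$ is written as a polyfract, having total degree $\deg(f)$ and partial degrees $\deg_i(f)$, then $$\mathrm{Fdeg}(f)=\deg(f)\quad\text{and}\quad \mathrm{Pdeg}_i(f)=\deg_i(f)\quad\text{for } i=1,2,\dots,n.$$
   Context: $\mathbb{N}$ contains $0$. Let $e_i\in\mathbb{Z}^n$ be the $i$-th standard basis vector. For $f\colon\mathbb{Z}^n\to B$ put $[\Delta_i f](x):=f(x+e_i)-f(x)$. The functional degree $\mathrm{Fdeg}(f)$ is the smallest integer $m\ge0$ such that $\Delta_1^{d_1}\Delta_2^{d_2}\cdots\Delta_n^{d_n}f\equiv0$ for all integers $d_1,\dots,d_n\ge0$ with $\sum_i d_i>m$, if such an $m$ exists, and $\infty$ otherwise. The $i$-th partial functional degree $\mathrm{Pdeg}_i(f)$ is the smallest integer $m\ge0$ such that $\Delta_i^{m+1}f\equiv0$, if such an $m$ exists, and $\infty$ otherwise. A $B$-polyfract is a formal finite sum $P=\sum_{\delta\in\mathbb{N}^n}b_\delta\binom{X_1}{\delta_1}\binom{X_2}{\delta_2}\cdots\binom{X_n}{\delta_n}$ with coefficients $b_\delta\in B$, only finitely many of them nonzero, where $\binom{X}{\delta}=\frac{X(X-1)\cdots(X-\delta+1)}{\delta!}$ and $\binom{X}{0}=1$. It gives the map $\mathbb{Z}^n\to B$, $x\mapsto\sum_\delta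 b_\delta\binom{x_1}{\delta_1}\cdots\binom{x_n}{\delta_n}$, where integers act on $B$ by the $\mathbb{Z}$-module structure; different polyfracts give different maps, and a polyfract is identified with its map. For $P\ne0$, $\deg(P):=\max_{b_\delta\ne0}(\delta_1+\dots+\delta_n)$ and $\deg_i(P):=\max_{b_\delta\neq0}\delta_i$; also $\deg(0):=0$ and $\deg_i(0):=0$. *)

theory Defs
  imports "HOL-Analysis.Finite_Cartesian_Product" "HOL-Library.Poly_Mapping"
    "HOL-Library.Extended_Nat"
begin

definition fdiff :: "'n::finite \<Rightarrow> (int^'n \<Rightarrow> 'b::ab_group_add) \<Rightarrow> int^'n \<Rightarrow> 'b" where
  "fdiff i f x = f (x + axis i 1) - f x"

lemma fdiff_commute: "fdiff i (fdiff j f) = fdiff j (fdiff i f)"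
  by (rule ext) (simp add: fdiff_def algebra_simps)

lemma fdiff_funpow_commute:
  "(fdiff i ^^ k) ((fdiff j ^^ l) f) = (fdiff j ^^ l) ((fdiff i ^^ k) f)"
proof -
  have step: "fdiff i ((fdiff j ^^ l) g) = (fdiff j ^^ l) (fdiff i g)" for g
    by (induction l arbitrary: g) (simp_all add: fdiff_commute[of i j])
  show ?thesis
    by (induction k arbitrary: f) (simp_all add: step)
qed

text \<open>
  The product of the operators \<^term>\<open>fdiff i ^^ d i\<close> over all coordinates. As these operators
  commute, no order on the index type is needed; \<open>mixed_fdiff_enum\<close> below confirms that the
  factors may be composed in any order.
\<close>

definition mixed_fdiff ::
    "('n::finite \<Rightarrow> nat) \<Rightarrow> (int^'n \<Rightarrow> 'b::ab_group_add) \<Rightarrow> int^'n \<Rightarrow> 'b" where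
  "mixed_fdiff d f = Finite_Set.fold (\<lambda>i. fdiff i ^^ d i) f UNIV"

interpretation fdiff_fold: comp_fun_commute "\<lambda>i. fdiff i ^^ d i"
  by unfold_locales (simp add: fun_eq_iff fdiff_funpow_commute)

lemma mixed_fdiff_enum:
  assumes "distinct is" "set is = UNIV"
  shows "mixed_fdiff d f = foldr (\<lambda>i. fdiff i ^^ d i) is f"
proof -
  have "Finite_Set.fold (\<lambda>i. fdiff i ^^ d i) f (set is) = foldr (\<lambda>i. fdiff i ^^ d i) is f"
    using assms(1) by (induction "is") simp_all
  then show ?thesis
    by (simp add: mixed_fdiff_def assms(2))
qed

definition Fdeg :: "(int^'n::finite \<Rightarrow> 'b::ab_group_add) \<Rightarrow> enat" where
  "Fdeg f =
    (let bound = (\<lambda>m. \<forall>d. (\<Sum>i\<in>UNIV. d i) > m \<longrightarrow> mixed_fdiff d f = (\<lambda>_. 0))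
     in if \<exists>m. bound m then enat (LEAST m. bound m) else \<infinity>)"

definition Pdeg :: "'n::finite \<Rightarrow> (int^'n \<Rightarrow> 'b::ab_group_add) \<Rightarrow> enat" where
  "Pdeg i f =
    (let bound = (\<lambda>m. (fdiff i ^^ (m + 1)) f = (\<lambda>_. 0))
     in if \<exists>m. bound m then enat (LEAST m. bound m) else \<infinity>)"

text \<open>
  The binomial coefficient of an arbitrary integer. The division is exact by
  \<open>fact_mult_ibinom\<close>. The library's \<^const>\<open>gbinomial\<close> cannot be written at type
  \<^typ>\<open>int\<close> here, since terms containing it are only read over fields of characteristic
  zero; \<open>of_int_ibinom\<close> relates the two.
\<close>

definition ibinom :: "int \<Rightarrow> nat \<Rightarrow> int" where
  "ibinom x k = (\<Prod>j<k. x - int j) div fact k"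

lemma fact_mult_ibinom: "fact k * ibinom x k = (\<Prod>j<k. x - int j)"
proof -
  have "(\<Prod>j<k. x - int j) = pochhammer (x - int k + 1) k"
    using falling_fact_pochhammer'[of x k] by (simp add: atLeast0LessThan)
  then show ?thesis
    by (simp add: ibinom_def fact_dvd_pochhammer)
qed

lemma of_int_ibinom: "of_int (ibinom x k) = (of_int x :: 'a::field_char_0) gchoose k"
proof -
  have "fact k * of_int (ibinom x k) = (of_int (fact k * ibinom x k) :: 'a)"
    by simp
  also have "\<dots> = (\<Prod>j<k. of_int x - of_nat j)"
    by (simp only: fact_mult_ibinom) simp
  also have "\<dots> = fact k * (of_int x gchoose k)"
    by (simp add: gbinomial_mult_fact atLeast0LessThan)
  finally show ?thesis
    by simp
qed

text \<open>
  The action of the integers on an abelian group: at most one of the two sums is nonempty.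
\<close>

definition zscale :: "int \<Rightarrow> 'b::ab_group_add \<Rightarrow> 'b" where
  "zscale k b = (\<Sum>_<nat k. b) - (\<Sum>_<nat (- k). b)"

text \<open>
  A polyfract is the finitely supported family of its coefficients \<open>b\<^sub>\<delta>\<close>, indexed by the
  multi-exponents \<open>\<delta>\<close>.
\<close>

type_synonym ('b, 'n) polyfract = "(nat^'n) \<Rightarrow>\<^sub>0 'b"

definition polyfract_map :: "('b::ab_group_add, 'n::finite) polyfract \<Rightarrow> int^'n \<Rightarrow> 'b" where
  "polyfract_map P x =
    (\<Sum>\<delta>\<in>Poly_Mapping.keys P. zscale (\<Prod>i\<in>UNIV. ibinom (x $ i) (\<delta> $ i)) (Poly_Mapping.lookup P \<delta>))"

definition total_degree :: "('b::ab_group_add, 'n::finite) polyfract \<Rightarrow> nat" where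
  "total_degree P = (if P = 0 then 0 else Max ((\<lambda>\<delta>. \<Sum>i\<in>UNIV. \<delta> $ i) ` Poly_Mapping.keys P))"

definition partial_degree :: "'n::finite \<Rightarrow> ('b::ab_group_add, 'n) polyfract \<Rightarrow> nat" where
  "partial_degree i P = (if P = 0 then 0 else Max ((\<lambda>\<delta>. \<delta> $ i) ` Poly_Mapping.keys P))"

end

theory Submission
  imports Defs
begin

text \<open>
  Differencing treats the binomial monomials the way differentiation treats \<open>x\<^sup>k / k!\<close>: by Pascal's
  rule \<open>\<Delta>\<^sub>i\<close> lowers the \<open>i\<close>-th exponent by one, or kills the monomial if that exponent is zero. Hence
  \<open>\<Delta>\<^sup>d\<close> shifts the exponents of a polyfract down by \<open>d\<close> (\<open>mixed_fdiff_polyfract_map\<close>), and as a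
  monomial of nonzero exponent vanishes at the origin, there is a Taylor formula: the coefficient of
  \<open>P\<close> at \<open>d\<close> is the value of \<open>\<Delta>\<^sup>d P\<close> at the origin (\<open>taylor_coefficient\<close>).

  The shift shows that polyfracts have finite functional degree. For the converse, the candidate
  for a function \<open>f\<close> of finite degree is the polyfract with the Taylor coefficients of \<open>f\<close>. Its
  difference to \<open>f\<close> again has finite degree and all its Taylor coefficients are zero. Such a function
  vanishes (\<open>eq_0_if_taylor_coefficients_0\<close>), by induction on the degree: its differences vanish,
  so that it is constant, with value zero at the origin. Finite degree is essential here, since
  without it the Taylor coefficients determine a function on \<open>\<nat>\<^sup>n\<close> only.

  Finally, shift and Taylor formula together say that an operator \<open>\<Delta>\<^sup>d\<close> annihilates \<open>P\<close> if and only
  if no exponent \<open>\<delta>\<close> of a nonzero coefficient of \<open>P\<close> satisfies \<open>d \<le> \<delta>\<close> componentwise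
  (\<open>mixed_fdiff_polyfract_map_eq_0_iff\<close>). Both degree formulas are read off from this equivalence.
\<close>

section \<open>The mixed difference operators\<close>

lemma fdiff_zero [simp]: "fdiff i (\<lambda>_. 0) = (\<lambda>_. 0)"
  by (simp add: fdiff_def fun_eq_iff)

lemma fdiff_diff: "fdiff i (\<lambda>x. f x - g x) = (\<lambda>x. fdiff i f x - fdiff i g x)"
  by (simp add: fdiff_def fun_eq_iff algebra_simps)

lemma fdiff_sum: "fdiff i (\<lambda>x. \<Sum>a\<in>A. f a x) = (\<lambda>x. \<Sum>a\<in>A. fdiff i (f a) x)"
  by (simp add: fdiff_def fun_eq_iff sum_subtractf)

lemma mixed_fdiff_0 [simp]: "mixed_fdiff (\<lambda>_. 0) f = f"
proof -
  have "Finite_Set.fold (\<lambda>i. fdiff i ^^ 0) f S = f" if "finite S" for S :: "'a set"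
    using that
  proof (induction S rule: finite_induct)
    case (insert i S)
    then show ?case
      by (subst fdiff_fold.fold_insert[where d = "\<lambda>_. 0"]) (simp_all add: id_def)
  qed simp
  then show ?thesis
    by (simp add: mixed_fdiff_def)
qed

text \<open>
  Together with the empty operator, this recursion determines all mixed operators, so that the order
  of composition need not be considered again: every identity below follows by induction on the
  multi-index. As the difference that is peeled off is the innermost one, these inductions have to
  generalise over the function. The simplifier must not unfold function updates in them, since
  this recursion is stated for the update.
\<close>

lemma mixed_fdiff_Suc: "mixed_fdiff (d(i := Suc (d i))) f = mixed_fdiff d (fdiff i f)"
proof -
  let ?d = "d(i := Suc (d i))"
  \<comment> \<open>The factors commute, so that the one of \<open>i\<close> can be applied first.\<close>
  have split: "mixed_fdiff e g =
      Finite_Set.fold (\<lambda>j. fdiff j ^^ e j) ((fdiff i ^^ e i) g) (UNIV - {i})"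
    for e :: "'a \<Rightarrow> nat" and g :: "int^'a \<Rightarrow> 'b"
    using fdiff_fold.fold_insert2[of "UNIV - {i}" i e g]
    by (simp add: mixed_fdiff_def insert_UNIV)
  have "mixed_fdiff ?d f =
      Finite_Set.fold (\<lambda>j. fdiff j ^^ ?d j) ((fdiff i ^^ d i) (fdiff i f)) (UNIV - {i})"
    by (simp add: split funpow_swap1)
  also have "\<dots> = Finite_Set.fold (\<lambda>j. fdiff j ^^ d j) ((fdiff i ^^ d i) (fdiff i f)) (UNIV - {i})"
    by (rule fold_closed_eq[where B = UNIV]) auto
  finally show ?thesis
    by (simp add: split)
qed

lemma multiindex_induct [case_names zero Suc]:
  fixes d :: "'n::finite \<Rightarrow> nat"
  assumes zero: "P (\<lambda>_. 0)"
    and Suc: "\<And>d i. P d \<Longrightarrow> P (d(i := Suc (d i)))"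
  shows "P d"
proof (induction "\<Sum>i\<in>UNIV. d i" arbitrary: d)
  case 0
  then have "d = (\<lambda>_. 0)"
    by (simp add: fun_eq_iff)
  with zero show ?case
    by simp
next
  case (Suc m)
  then obtain i where i: "d i > 0"
    by (metis gr0I nat.distinct(1) sum.neutral)
  let ?e = "d(i := d i - 1)"
  have "(\<Sum>j\<in>UNIV. d j) = d i + (\<Sum>j\<in>UNIV - {i}. d j)"
    by (rule sum.remove) auto
  moreover have "(\<Sum>j\<in>UNIV. ?e j) = (d i - 1) + (\<Sum>j\<in>UNIV - {i}. d j)"
    by (subst sum.remove[of _ i]) auto
  ultimately have "m = (\<Sum>j\<in>UNIV. ?e j)"
    using Suc.hyps(2) i by simp
  then have "P ?e"
    by (rule Suc.hyps(1))
  then have "P (?e(i := Suc (?e i)))"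
    by (rule assms(2))
  with i show ?case
    by simp
qed

lemma mixed_fdiff_zero [simp]: "mixed_fdiff d (\<lambda>_. 0) = (\<lambda>_. 0)"
  by (induction d rule: multiindex_induct) (simp_all add: mixed_fdiff_Suc del: fun_upd_apply)

lemma mixed_fdiff_diff:
  "mixed_fdiff d (\<lambda>x. f x - g x) = (\<lambda>x. mixed_fdiff d f x - mixed_fdiff d g x)"
  by (induction d arbitrary: f g rule: multiindex_induct)
    (simp_all add: mixed_fdiff_Suc fdiff_diff del: fun_upd_apply)

lemma mixed_fdiff_sum:
  "mixed_fdiff d (\<lambda>x. \<Sum>a\<in>A. f a x) = (\<lambda>x. \<Sum>a\<in>A. mixed_fdiff d (f a) x)"
  by (induction d arbitrary: f rule: multiindex_induct)
    (simp_all add: mixed_fdiff_Suc fdiff_sum del: fun_upd_apply)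

lemma mixed_fdiff_fdiff_commute: "mixed_fdiff d (fdiff i f) = fdiff i (mixed_fdiff d f)"
  by (induction d arbitrary: f rule: multiindex_induct)
    (simp_all add: mixed_fdiff_Suc fdiff_commute[of _ i] del: fun_upd_apply)

lemma mixed_fdiff_add: "mixed_fdiff (\<lambda>i. d i + c i) f = mixed_fdiff c (mixed_fdiff d f)"
proof (induction c arbitrary: f rule: multiindex_induct)
  case (Suc c i)
  have "(\<lambda>j. d j + (c(i := Suc (c i))) j) = (\<lambda>j. d j + c j)(i := Suc (d i + c i))"
    by (simp add: fun_eq_iff)
  then have "mixed_fdiff (\<lambda>j. d j + (c(i := Suc (c i))) j) f =
      mixed_fdiff (\<lambda>j. d j + c j) (fdiff i f)"
    by (simp add: mixed_fdiff_Suc[of "\<lambda>j. d j + c j" i f])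
  also have "\<dots> = mixed_fdiff c (mixed_fdiff d (fdiff i f))"
    by (rule Suc.IH)
  also have "\<dots> = mixed_fdiff (c(i := Suc (c i))) (mixed_fdiff d f)"
    by (simp add: mixed_fdiff_Suc mixed_fdiff_fdiff_commute)
  finally show ?case .
qed simp

lemma funpow_fdiff_eq_mixed_fdiff: "(fdiff i ^^ k) f = mixed_fdiff ((\<lambda>_. 0)(i := k)) f"
proof (induction k arbitrary: f)
  case (Suc k)
  then show ?case
    using mixed_fdiff_Suc[of "(\<lambda>_. 0)(i := k)" i f]
    by (simp only: funpow_Suc_right o_apply fun_upd_same fun_upd_upd)
qed (simp add: fun_upd_idem)

section \<open>Binomial monomials\<close>

lemma ibinom_0_right [simp]: "ibinom x 0 = 1"
  by (simp add: ibinom_def)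

lemma ibinom_0_left: "ibinom 0 k = (if k = 0 then 1 else 0)"
proof (cases "k = 0")
  case False
  then have "(\<Prod>j<k. 0 - int j) = 0"
    by (intro prod_zero) (auto intro: bexI[of _ 0])
  with False show ?thesis
    by (simp only: ibinom_def) simp
qed simp

lemma ibinom_Suc: "ibinom (x + 1) (Suc k) = ibinom x (Suc k) + ibinom x k"
proof -
  \<comment> \<open>Over the reals this is the rule for generalised binomial coefficients.\<close>
  have "real_of_int (ibinom (x + 1) (Suc k)) = real_of_int (ibinom x (Suc k) + ibinom x k)"
    by (simp add: of_int_ibinom gbinomial_Suc_Suc)
  then show ?thesis
    by (simp only: of_int_eq_iff)
qed

lemma zscale_0 [simp]: "zscale 0 b = 0"
  by (simp add: zscale_def)

lemma zscale_1 [simp]: "zscale 1 b = b"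
  by (simp add: zscale_def)

lemma sum_lessThan_const_add:
  "(\<Sum>_<m + n. b) = (\<Sum>_<m. b) + (\<Sum>_<n. b :: 'b::ab_group_add)" for m n :: nat
  by (induction n) (simp_all add: add.assoc)

text \<open>
  An integer is scaled correctly by each of its representations as a difference of natural
  numbers. This reduces additivity to that of sums, without a distinction of signs.
\<close>

lemma zscale_diff_nat: "zscale (int m - int n) b = (\<Sum>_<m. b) - (\<Sum>_<n. b)"
proof -
  consider r where "m = n + r" | r where "n = m + r"
    by (metis less_eqE nat_le_linear)
  then show ?thesis
    by cases (simp_all add: zscale_def sum_lessThan_const_add)
qed

lemma zscale_add: "zscale (k + l) b = zscale k b + zscale l b"
proof -
  obtain m n p q where "k = int m - int n" "l = int p - int q"
    by (metis int_diff_cases)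
  moreover have "zscale (int m - int n + (int p - int q)) b = (\<Sum>_<m + p. b) - (\<Sum>_<n + q. b)"
    using zscale_diff_nat[of "m + p" "n + q" b] by (simp add: algebra_simps)
  ultimately show ?thesis
    by (simp add: zscale_diff_nat sum_lessThan_const_add)
qed

definition binomial_monomial :: "nat^'n::finite \<Rightarrow> 'b::ab_group_add \<Rightarrow> int^'n \<Rightarrow> 'b" where
  "binomial_monomial \<delta> b x = zscale (\<Prod>i\<in>UNIV. ibinom (x $ i) (\<delta> $ i)) b"

lemma polyfract_map_eq_sum:
  "polyfract_map P =
    (\<lambda>x. \<Sum>\<delta>\<in>Poly_Mapping.keys P. binomial_monomial \<delta> (Poly_Mapping.lookup P \<delta>) x)"
  by (simp add: polyfract_map_def binomial_monomial_def fun_eq_iff)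

text \<open>Pascal's rule in the \<open>i\<close>-th factor; the other factors do not change under the shift.\<close>

lemma fdiff_binomial_monomial:
  "fdiff i (binomial_monomial \<delta> b) =
    (if \<delta> $ i = 0 then (\<lambda>_. 0)
     else binomial_monomial (\<chi> j. if j = i then \<delta> $ i - 1 else \<delta> $ j) b)"
proof (rule ext)
  fix x :: "int^'a"
  define R where "R = (\<Prod>j\<in>UNIV - {i}. ibinom (x $ j) (\<delta> $ j))"
  have split: "(\<Prod>j\<in>UNIV. ibinom (y $ j) (\<epsilon> $ j)) = ibinom (y $ i) (\<epsilon> $ i) * R"
    if "\<And>j. j \<noteq> i \<Longrightarrow> y $ j = x $ j \<and> \<epsilon> $ j = \<delta> $ j" for y :: "int^'a" and \<epsilon>
    using that by (simp add: R_def prod.remove[of UNIV i])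
  have "binomial_monomial \<delta> b (x + axis i 1) = zscale (ibinom (x $ i + 1) (\<delta> $ i) * R) b"
    using split[of "x + axis i 1" \<delta>] by (simp add: binomial_monomial_def axis_def)
  moreover have "binomial_monomial \<delta> b x = zscale (ibinom (x $ i) (\<delta> $ i) * R) b"
    by (simp add: binomial_monomial_def split)
  moreover have "binomial_monomial (\<chi> j. if j = i then \<delta> $ i - 1 else \<delta> $ j) b x =
      zscale (ibinom (x $ i) (\<delta> $ i - 1) * R) b"
    using split[of x "\<chi> j. if j = i then \<delta> $ i - 1 else \<delta> $ j"]
    by (simp add: binomial_monomial_def)
  ultimately show "fdiff i (binomial_monomial \<delta> b) x =
      (if \<delta> $ i = 0 then (\<lambda>_. 0)
       else binomial_monomial (\<chi> j. if j = i then \<delta> $ i - 1 else \<delta> $ j) b) x"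
    by (cases "\<delta> $ i") (simp_all add: fdiff_def ibinom_Suc distrib_right zscale_add)
qed

lemma mixed_fdiff_binomial_monomial:
  "mixed_fdiff d (binomial_monomial \<delta> b) =
    (if \<forall>i. d i \<le> \<delta> $ i then binomial_monomial (\<chi> i. \<delta> $ i - d i) b else (\<lambda>_. 0))"
proof (induction d arbitrary: \<delta> rule: multiindex_induct)
  case (Suc d i)
  let ?\<delta> = "\<chi> j. if j = i then \<delta> $ i - 1 else \<delta> $ j"
  show ?case
  proof (cases "\<delta> $ i = 0")
    case True
    then have "\<not> (\<forall>j. (d(i := Suc (d i))) j \<le> \<delta> $ j)"
      by (auto intro!: exI[of _ i])
    moreover have "mixed_fdiff (d(i := Suc (d i))) (binomial_monomial \<delta> b) = (\<lambda>_. 0)"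
      by (simp add: True mixed_fdiff_Suc fdiff_binomial_monomial del: fun_upd_apply)
    ultimately show ?thesis
      by (simp only: if_False)
  next
    case False
    then have "(\<forall>j. d j \<le> ?\<delta> $ j) \<longleftrightarrow> (\<forall>j. (d(i := Suc (d i))) j \<le> \<delta> $ j)"
      by (intro iff_allI) auto
    moreover have "(\<chi> j. ?\<delta> $ j - d j) = (\<chi> j. \<delta> $ j - (d(i := Suc (d i))) j)"
      by (simp add: vec_eq_iff)
    ultimately show ?thesis
      using False by (simp only: mixed_fdiff_Suc fdiff_binomial_monomial Suc.IH if_False)
  qed
qed simp

lemma binomial_monomial_at_0:
  fixes \<delta> :: "nat^'n::finite"
  shows "binomial_monomial \<delta> b 0 = (if \<delta> = 0 then b else 0)"
proof (cases "\<delta> = 0")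
  case False
  then obtain i where "\<delta> $ i \<noteq> 0"
    by (auto simp: vec_eq_iff)
  then have "(\<Prod>i\<in>UNIV. ibinom ((0 :: int^'n) $ i) (\<delta> $ i)) = 0"
    by (intro prod_zero) (auto simp: ibinom_0_left)
  with False show ?thesis
    by (simp only: binomial_monomial_def zscale_0 if_False)
qed (simp add: binomial_monomial_def)

section \<open>Taylor coefficients\<close>

lemma mixed_fdiff_polyfract_map:
  "mixed_fdiff d (polyfract_map P) =
    (\<lambda>x. \<Sum>\<delta>\<in>Poly_Mapping.keys P.
      (if \<forall>i. d i \<le> \<delta> $ i
       then binomial_monomial (\<chi> i. \<delta> $ i - d i) (Poly_Mapping.lookup P \<delta>) else (\<lambda>_. 0)) x)"
  by (simp add: polyfract_map_eq_sum mixed_fdiff_sum mixed_fdiff_binomial_monomial)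

lemma taylor_coefficient:
  fixes d :: "'n::finite \<Rightarrow> nat"
  shows "mixed_fdiff d (polyfract_map P) 0 = Poly_Mapping.lookup P (\<chi> i. d i)"
proof -
  \<comment> \<open>The subtraction is truncated, so that \<open>\<delta> - d = 0\<close> means \<open>\<delta> \<le> d\<close>.\<close>
  have eq: "(\<forall>i. d i \<le> \<delta> $ i) \<and> (\<chi> i. \<delta> $ i - d i) = 0 \<longleftrightarrow> \<delta> = (\<chi> i. d i)" for \<delta> :: "nat^'n"
    by (auto simp: vec_eq_iff intro: antisym)
  have "mixed_fdiff d (polyfract_map P) 0 =
      (\<Sum>\<delta>\<in>Poly_Mapping.keys P. if \<delta> = (\<chi> i. d i) then Poly_Mapping.lookup P \<delta> else 0)"
    unfolding mixed_fdiff_polyfract_map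
    by (intro sum.cong refl) (simp add: binomial_monomial_at_0 flip: eq)
  also have "\<dots> = Poly_Mapping.lookup P (\<chi> i. d i)"
    by (simp add: sum.delta' in_keys_iff)
  finally show ?thesis .
qed

lemma mixed_fdiff_eq_0_mono:
  assumes "mixed_fdiff d f = (\<lambda>_. 0)" and "\<And>i. d i \<le> e i"
  shows "mixed_fdiff e f = (\<lambda>_. 0)"
proof -
  have "mixed_fdiff (\<lambda>i. d i + (e i - d i)) f = (\<lambda>_. 0)"
    by (simp only: mixed_fdiff_add assms(1) mixed_fdiff_zero)
  with assms(2) show ?thesis
    by simp
qed

text \<open>
  If \<open>\<Delta>\<^sup>d\<close> annihilates the polyfract and \<open>d \<le> \<delta>\<close>, then so does \<open>\<Delta>\<^sup>\<delta>\<close>, which factors through \<open>\<Delta>\<^sup>d\<close>.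
  By the Taylor formula, the coefficient at \<open>\<delta>\<close> is therefore zero. The converse is the shift of exponents.
\<close>

lemma mixed_fdiff_polyfract_map_eq_0_iff:
  "mixed_fdiff d (polyfract_map P) = (\<lambda>_. 0) \<longleftrightarrow>
    (\<forall>\<delta>\<in>Poly_Mapping.keys P. \<not> (\<forall>i. d i \<le> \<delta> $ i))"
proof
  assume *: "mixed_fdiff d (polyfract_map P) = (\<lambda>_. 0)"
  show "\<forall>\<delta>\<in>Poly_Mapping.keys P. \<not> (\<forall>i. d i \<le> \<delta> $ i)"
  proof (intro ballI notI)
    fix \<delta> assume \<delta>: "\<delta> \<in> Poly_Mapping.keys P" "\<forall>i. d i \<le> \<delta> $ i"
    then have "mixed_fdiff (($) \<delta>) (polyfract_map P) = (\<lambda>_. 0)"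
      using mixed_fdiff_eq_0_mono[OF *] by blast
    then have "Poly_Mapping.lookup P \<delta> = 0"
      using taylor_coefficient[of "($) \<delta>" P] by simp
    with \<delta>(1) show False
      by (simp add: in_keys_iff)
  qed
next
  assume "\<forall>\<delta>\<in>Poly_Mapping.keys P. \<not> (\<forall>i. d i \<le> \<delta> $ i)"
  then show "mixed_fdiff d (polyfract_map P) = (\<lambda>_. 0)"
    unfolding mixed_fdiff_polyfract_map by (intro ext sum.neutral) (simp del: not_all)
qed

section \<open>Functions of finite degree\<close>

lemma const_if_fdiffs_0:
  fixes f :: "int^'n::finite \<Rightarrow> 'b::ab_group_add"
  assumes "\<And>i. fdiff i f = (\<lambda>_. 0)"
  shows "f x = f 0"
proof -
  have step: "f (x + axis i 1) = f x" for x i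
    using fun_cong[OF assms[of i], of x] by (simp add: fdiff_def)
  \<comment> \<open>Steps in both directions reach negative coordinates too.\<close>
  have line: "f (x + axis i k) = f x" for x i k
  proof (induction k rule: int_induct[where k = 0])
    case base
    have "axis i 0 = (0 :: int^'n)"
      by (simp add: axis_def vec_eq_iff)
    then show ?case
      by (simp only: add_0_right)
  next
    case (step1 k)
    have "x + axis i (k + 1) = (x + axis i k) + axis i 1"
      by (simp add: axis_def vec_eq_iff)
    with step step1 show ?case
      by (simp flip: add.assoc)
  next
    case (step2 k)
    have "x + axis i k = (x + axis i (k - 1)) + axis i 1"
      by (simp add: axis_def vec_eq_iff)
    with step step2 show ?case
      by metis
  qed
  \<comment> \<open>Walk from the origin to \<open>x\<close>, one coordinate at a time.\<close>
  have "f (\<chi> j. if j \<in> S then x $ j else 0) = f 0" if "finite S" for S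
    using that
  proof (induction S rule: finite_induct)
    case empty
    have "(\<chi> j. 0) = (0 :: int^'n)"
      by (simp add: vec_eq_iff)
    then show ?case
      by simp
  next
    case (insert i S)
    have "(\<chi> j. if j \<in> insert i S then x $ j else 0) =
        (\<chi> j. if j \<in> S then x $ j else 0) + axis i (x $ i)"
      using insert.hyps by (auto simp: axis_def vec_eq_iff)
    with line insert.IH show ?case
      by simp
  qed
  from this[of UNIV] show ?thesis
    by simp
qed

text \<open>
  The bound is put as \<open>m \<le> |d|\<close>, not as \<open>m < |d|\<close>, so that the induction starts with \<open>f = 0\<close> itself.
\<close>

lemma eq_0_if_taylor_coefficients_0:
  fixes f :: "int^'n::finite \<Rightarrow> 'b::ab_group_add"
  assumes "\<And>d. m \<le> (\<Sum>i\<in>UNIV. d i) \<Longrightarrow> mixed_fdiff d f = (\<lambda>_. 0)"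
    and "\<And>d. mixed_fdiff d f 0 = 0"
  shows "f = (\<lambda>_. 0)"
  using assms
proof (induction m arbitrary: f)
  case 0
  from "0.prems"(1)[of "\<lambda>_. 0"] show ?case
    by simp
next
  case (Suc m)
  have "fdiff i f = (\<lambda>_. 0)" for i
  proof (rule Suc.IH)
    fix d :: "'n \<Rightarrow> nat"
    assume "m \<le> (\<Sum>i\<in>UNIV. d i)"
    moreover have "(\<Sum>j\<in>UNIV. (d(i := Suc (d i))) j) = Suc (\<Sum>j\<in>UNIV. d j)"
      by (simp add: sum.remove[of UNIV i])
    ultimately show "mixed_fdiff d (fdiff i f) = (\<lambda>_. 0)"
      using Suc.prems(1)[of "d(i := Suc (d i))"]
      by (simp add: mixed_fdiff_Suc del: fun_upd_apply)
  next
    show "mixed_fdiff d (fdiff i f) 0 = 0" for d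
      using Suc.prems(2)[of "d(i := Suc (d i))"]
      by (simp add: mixed_fdiff_Suc del: fun_upd_apply)
  qed
  then have "f x = f 0" for x
    by (rule const_if_fdiffs_0)
  moreover have "f 0 = 0"
    using Suc.prems(2)[of "\<lambda>_. 0"] by simp
  ultimately show ?case
    by (simp add: fun_eq_iff)
qed

lemma finite_multiindices_le: "finite {\<delta> :: nat^'n::finite. (\<Sum>i\<in>UNIV. \<delta> $ i) \<le> m}"
proof (rule finite_subset)
  show "{\<delta> :: nat^'n. (\<Sum>i\<in>UNIV. \<delta> $ i) \<le> m} \<subseteq> vec_lambda ` (PiE UNIV (\<lambda>_. {..m}))"
  proof
    fix \<delta> :: "nat^'n"
    assume "\<delta> \<in> {\<delta>. (\<Sum>i\<in>UNIV. \<delta> $ i) \<le> m}"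
    then have "\<delta> $ i \<le> m" for i
      using member_le_sum[of i UNIV "($) \<delta>"] by (simp add: le_trans)
    then have "($) \<delta> \<in> PiE UNIV (\<lambda>_. {..m})"
      by auto
    then show "\<delta> \<in> vec_lambda ` (PiE UNIV (\<lambda>_. {..m}))"
      by (metis image_eqI vec_nth_inverse)
  qed
  show "finite (vec_lambda ` (PiE (UNIV :: 'n set) (\<lambda>_. {..m})))"
    by (intro finite_imageI finite_PiE) auto
qed

text \<open>
  The polyfract with the Taylor coefficients of \<open>f\<close> has total degree at most \<open>m\<close>, so that its
  difference to \<open>f\<close> inherits the bound and is zero because all its Taylor coefficients are.
\<close>

lemma polyfract_map_if_bounded:
  fixes f :: "int^'n::finite \<Rightarrow> 'b::ab_group_add"
  assumes bound: "\<And>d. m < (\<Sum>i\<in>UNIV. d i) \<Longrightarrow> mixed_fdiff d f = (\<lambda>_. 0)"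
  shows "f \<in> range polyfract_map"
proof -
  define c where "c = (\<lambda>\<delta> :: nat^'n. mixed_fdiff (($) \<delta>) f 0)"
  have c_0: "c \<delta> = 0" if "m < (\<Sum>i\<in>UNIV. \<delta> $ i)" for \<delta>
    using bound[OF that] by (simp add: c_def)
  have "finite {\<delta>. c \<delta> \<noteq> 0}"
    by (rule finite_subset[OF _ finite_multiindices_le[of m]]) (use c_0 in \<open>force simp: not_less\<close>)
  then have lookup: "Poly_Mapping.lookup (Abs_poly_mapping c) = c"
    by (rule lookup_Abs_poly_mapping)
  define P where "P = Abs_poly_mapping c"
  have keys: "(\<Sum>i\<in>UNIV. \<delta> $ i) \<le> m" if "\<delta> \<in> Poly_Mapping.keys P" for \<delta>
    using that c_0 by (force simp: P_def in_keys_iff lookup not_less)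
  have "(\<lambda>x. f x - polyfract_map P x) = (\<lambda>_. 0)"
  proof (rule eq_0_if_taylor_coefficients_0)
    fix d :: "'n \<Rightarrow> nat"
    assume d: "Suc m \<le> (\<Sum>i\<in>UNIV. d i)"
    have "mixed_fdiff d (polyfract_map P) = (\<lambda>_. 0)"
      unfolding mixed_fdiff_polyfract_map_eq_0_iff
    proof (intro ballI notI)
      fix \<delta> assume "\<delta> \<in> Poly_Mapping.keys P" "\<forall>i. d i \<le> \<delta> $ i"
      with keys[of \<delta>] sum_mono[of UNIV d "($) \<delta>"] d show False
        by simp
    qed
    with bound[of d] d show "mixed_fdiff d (\<lambda>x. f x - polyfract_map P x) = (\<lambda>_. 0)"
      by (simp add: mixed_fdiff_diff)
  next
    show "mixed_fdiff d (\<lambda>x. f x - polyfract_map P x) 0 = 0" for d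
      by (simp add: mixed_fdiff_diff taylor_coefficient P_def lookup)
        (simp add: c_def vec_lambda_inverse)
  qed
  then have "f = polyfract_map P"
    by (simp add: fun_eq_iff)
  then show ?thesis
    by blast
qed

section \<open>Degrees of polyfracts\<close>

lemma total_degree_le_iff:
  "total_degree P \<le> m \<longleftrightarrow> (\<forall>\<delta>\<in>Poly_Mapping.keys P. (\<Sum>i\<in>UNIV. \<delta> $ i) \<le> m)"
  by (auto simp: total_degree_def)

lemma partial_degree_le_iff:
  "partial_degree i P \<le> m \<longleftrightarrow> (\<forall>\<delta>\<in>Poly_Mapping.keys P. \<delta> $ i \<le> m)"
  by (auto simp: partial_degree_def)

text \<open>
  An exponent \<open>\<delta>\<close> of \<open>P\<close> with \<open>m < |\<delta>|\<close> violates the bound at \<open>d = \<delta>\<close>. Conversely, \<open>m < |d|\<close> and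
  \<open>d \<le> \<delta>\<close> imply \<open>m < |\<delta>|\<close>.
\<close>

lemma bound_iff_total_degree_le:
  "(\<forall>d. (\<Sum>i\<in>UNIV. d i) > m \<longrightarrow> mixed_fdiff d (polyfract_map P) = (\<lambda>_. 0)) \<longleftrightarrow>
    total_degree P \<le> m"
  unfolding mixed_fdiff_polyfract_map_eq_0_iff total_degree_le_iff
proof safe
  fix \<delta>
  assume "\<forall>d. m < (\<Sum>i\<in>UNIV. d i) \<longrightarrow> (\<forall>\<delta>\<in>Poly_Mapping.keys P. \<not> (\<forall>i. d i \<le> \<delta> $ i))"
    and "\<delta> \<in> Poly_Mapping.keys P"
  then show "(\<Sum>i\<in>UNIV. \<delta> $ i) \<le> m"
    by (meson leI order_refl)
next
  fix d \<delta>
  assume "\<forall>\<delta>\<in>Poly_Mapping.keys P. (\<Sum>i\<in>UNIV. \<delta> $ i) \<le> m" "m < (\<Sum>i\<in>UNIV. d i)"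
    and "\<delta> \<in> Poly_Mapping.keys P" "\<forall>i. d i \<le> \<delta> $ i"
  then show False
    using sum_mono[of UNIV d "($) \<delta>"] by fastforce
qed

text \<open>Here only \<open>d = (m + 1) e\<^sub>i\<close> is tested, and \<open>d \<le> \<delta>\<close> is the condition \<open>m < \<delta>\<^sub>i\<close>.\<close>

lemma bound_iff_partial_degree_le:
  "(fdiff i ^^ (m + 1)) (polyfract_map P) = (\<lambda>_. 0) \<longleftrightarrow> partial_degree i P \<le> m"
  unfolding funpow_fdiff_eq_mixed_fdiff mixed_fdiff_polyfract_map_eq_0_iff partial_degree_le_iff
  by (auto simp: not_le Suc_le_eq)

lemma Least_ge: "(LEAST m. k \<le> m) = (k :: nat)"
  by (rule Least_equality) auto

lemma Fdeg_polyfract_map: "Fdeg (polyfract_map P) = enat (total_degree P)"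
  unfolding Fdeg_def Let_def bound_iff_total_degree_le by (auto simp: Least_ge)

lemma Pdeg_polyfract_map: "Pdeg i (polyfract_map P) = enat (partial_degree i P)"
  unfolding Pdeg_def Let_def bound_iff_partial_degree_le by (auto simp: Least_ge)

lemma polyfract_map_if_Fdeg_finite:
  assumes "Fdeg f < \<infinity>"
  shows "f \<in> range polyfract_map"
proof -
  obtain m where "\<forall>d. (\<Sum>i\<in>UNIV. d i) > m \<longrightarrow> mixed_fdiff d f = (\<lambda>_. 0)"
    using assms by (auto simp: Fdeg_def Let_def split: if_splits)
  then show ?thesis
    by (intro polyfract_map_if_bounded) blast
qed

theorem theorem3p5:
  "{f :: int^'n::finite \<Rightarrow> 'b::ab_group_add. Fdeg f < \<infinity>} = range polyfract_map \<and>
   (\<forall>(f :: int^'n \<Rightarrow> 'b) P. Fdeg f < \<infinity> \<and> f = polyfract_map P \<longrightarrow>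
      Fdeg f = enat (total_degree P) \<and> (\<forall>i. Pdeg i f = enat (partial_degree i P)))"
  using polyfract_map_if_Fdeg_finite by (auto simp: Fdeg_polyfract_map Pdeg_polyfract_map)

end
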